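(* Let $\mathbf{B}$ be a finite relational structure with universe $B$, $D$ a finite set, and $F$ an encoding for $\mathbf{B}$ over $D$ in which every map has arity at most $1$ and with $B_0\subseteq F$. Then $\mathbf{B}$ is $F$-stable if and only if for every finite set $W$ with $1\le|W|\le|B|$, the set $T_W=\{t[g]\mid g\in G_{W,D}\}$ is surjectively closed over $\mathbf{B}$.
   Context: A $\wedge$-formula is a conjunction of atoms $R(v_1,\dots,v_k)$ and variable equalities with the usual satisfaction over $\mathbf{B}$. For a finite set $S$, a set of maps $S\to B$ is $\wedge$-definable if it is the set of satisfying assignments $S\to B$ of a $\wedge$-formula with variables from $S$; $\langle T\rangle_{\mathbf{B}}$ is the smallest $\wedge$-definable set containing $T$. An automorphism is a bijection of $B$ preserving each relation in both directions. A set $T$ of maps $I\to B$ is surjectively closed over $\mathbf{B}$ if every surjective map in $\langle T\rangle_{\mathbf{B}}$ equals $\gamma\circ t$ with $\gamma$ an automorphism and $t\in T$. An encoding over $D$: a finite set $F$ of maps $f: D^k\to B$ ($k\ge0$ the arity; $D^0=\{\text{empty tuple}\}$). For $b\in B$, $b_0$ is the map $D^0\to B$ sending the empty tuple to $b$, and $B_0=\{b_0\mid b\in B\}$. For a finite set $V$: $G_{V,D}$ = maps $V\to D$; a $(V,F)$-application is $(\bar v,f)$ with $f\in F$ and $\bar v$ a tuple over $V$ of length the arity of $f$; $A_{V,F}$ the set of them; $\alpha[g]=f(g(v_1),\dots,g(v_k))$ for $\alpha=((v_1,\dots,v_k),f)$; $t[g]:A_{V,F}\to B$, $\alpha\mapsto\alpha[g]$;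 $T_V=\{t[g]\mid g\in G_{V,D}\}$. $\mathbf{B}$ is $F$-stable if for every non-empty finite $V$, every map in $T_V$ is surjective and $T_V$ is surjectively closed over $\mathbf{B}$. *)

theory Defs
  imports Main "HOL-Library.FuncSet"
begin

text \<open>Maps between sets, such as \<open>S \<rightarrow> B\<close>, are rendered as extensional functions
  (elements of \<open>S \<rightarrow>\<^sub>E B\<close>), so that equality of maps is equality of functions.
  The power \<open>D\<^sup>k\<close> is the set of lists of length \<open>k\<close> over \<open>D\<close>.\<close>

definition tuples :: "'a set \<Rightarrow> nat \<Rightarrow> 'a list set" where
  "tuples D k = {xs. set xs \<subseteq> D \<and> length xs = k}"

subsection \<open>Relational structures and conjunctive formulas\<close>

record ('r, 'b) relstr =
  univ :: "'b set"
  syms :: "'r set"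
  arity :: "'r \<Rightarrow> nat"
  interp :: "'r \<Rightarrow> 'b list set"

text \<open>Universes are nonempty, as usual for structures; finiteness of a structure means
  finiteness of its universe.\<close>

definition finite_relstr :: "('r, 'b) relstr \<Rightarrow> bool" where
  "finite_relstr B \<longleftrightarrow> finite (univ B) \<and> univ B \<noteq> {} \<and>
     (\<forall>R\<in>syms B. interp B R \<subseteq> tuples (univ B) (arity B R))"

definition automorphism :: "('r, 'b) relstr \<Rightarrow> ('b \<Rightarrow> 'b) \<Rightarrow> bool" where
  "automorphism B \<gamma> \<longleftrightarrow> bij_betw \<gamma> (univ B) (univ B) \<and>
     (\<forall>R\<in>syms B. \<forall>xs\<in>tuples (univ B) (arity B R).
        xs \<in> interp B R \<longleftrightarrow> map \<gamma> xs \<in> interp B R)"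

datatype ('r, 's) atom = Rel 'r "'s list" | Eq 's 's

fun atom_over :: "('r, 'b) relstr \<Rightarrow> 's set \<Rightarrow> ('r, 's) atom \<Rightarrow> bool" where
  "atom_over B S (Rel R vs) \<longleftrightarrow> R \<in> syms B \<and> vs \<in> tuples S (arity B R)"
| "atom_over B S (Eq u v) \<longleftrightarrow> u \<in> S \<and> v \<in> S"

fun sat :: "('r, 'b) relstr \<Rightarrow> ('s \<Rightarrow> 'b) \<Rightarrow> ('r, 's) atom \<Rightarrow> bool" where
  "sat B h (Rel R vs) \<longleftrightarrow> map h vs \<in> interp B R"
| "sat B h (Eq u v) \<longleftrightarrow> h u = h v"

text \<open>A \<open>\<and>\<close>-formula is the list of its conjuncts.\<close>

definition and_definable :: "('r, 'b) relstr \<Rightarrow> 's set \<Rightarrow> ('s \<Rightarrow> 'b) set \<Rightarrow> bool" where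
  "and_definable B S X \<longleftrightarrow> (\<exists>\<phi>. (\<forall>a\<in>set \<phi>. atom_over B S a) \<and>
     X = {h \<in> S \<rightarrow>\<^sub>E univ B. \<forall>a\<in>set \<phi>. sat B h a})"

definition and_hull :: "('r, 'b) relstr \<Rightarrow> 's set \<Rightarrow> ('s \<Rightarrow> 'b) set \<Rightarrow> ('s \<Rightarrow> 'b) set" where
  "and_hull B S T = (LEAST X. and_definable B S X \<and> T \<subseteq> X)"

definition surjectively_closed :: "('r, 'b) relstr \<Rightarrow> 's set \<Rightarrow> ('s \<Rightarrow> 'b) set \<Rightarrow> bool" where
  "surjectively_closed B S T \<longleftrightarrow>
     (\<forall>h\<in>and_hull B S T. h ` S = univ B \<longrightarrow>
        (\<exists>\<gamma> t. automorphism B \<gamma> \<and> t \<in> T \<and> h = compose S \<gamma> t))"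

subsection \<open>Encodings and stability\<close>

text \<open>A map \<open>f : D\<^sup>k \<rightarrow> B\<close> is a pair of its arity \<open>k\<close> and an extensional function on
  \<open>tuples D k\<close>; the arity is kept because it is not determined by the function if \<open>D\<close> is empty.\<close>

type_synonym ('d, 'b) emap = "nat \<times> ('d list \<Rightarrow> 'b)"

definition encoding :: "('r, 'b) relstr \<Rightarrow> 'd set \<Rightarrow> ('d, 'b) emap set \<Rightarrow> bool" where
  "encoding B D F \<longleftrightarrow> finite F \<and> (\<forall>(k, f)\<in>F. f \<in> tuples D k \<rightarrow>\<^sub>E univ B)"

definition const_map :: "'b \<Rightarrow> ('d, 'b) emap" where
  "const_map b = (0, \<lambda>xs\<in>{[]}. b)"

definition const_maps :: "('r, 'b) relstr \<Rightarrow> ('d, 'b) emap set" where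
  "const_maps B = const_map ` univ B"

definition apps :: "'v set \<Rightarrow> ('d, 'b) emap set \<Rightarrow> ('v list \<times> ('d, 'b) emap) set" where
  "apps V F = {(vs, f). f \<in> F \<and> vs \<in> tuples V (fst f)}"

definition app_value :: "('v \<Rightarrow> 'd) \<Rightarrow> 'v list \<times> ('d, 'b) emap \<Rightarrow> 'b" where
  "app_value g \<alpha> = (case \<alpha> of (vs, k, f) \<Rightarrow> f (map g vs))"

definition t_map ::
  "'v set \<Rightarrow> ('d, 'b) emap set \<Rightarrow> ('v \<Rightarrow> 'd) \<Rightarrow> ('v list \<times> ('d, 'b) emap) \<Rightarrow> 'b" where
  "t_map V F g = (\<lambda>\<alpha>\<in>apps V F. app_value g \<alpha>)"

definition T_set ::
  "'d set \<Rightarrow> ('d, 'b) emap set \<Rightarrow> 'v set \<Rightarrow> (('v list \<times> ('d, 'b) emap) \<Rightarrow> 'b) set" where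
  "T_set D F V = {t_map V F g | g. g \<in> V \<rightarrow>\<^sub>E D}"

text \<open>The finite sets \<open>V\<close> of the definition of stability are taken as sets of natural numbers;
  by \<open>surjectively_closed_T_set_card\<close> below, only the cardinality of \<open>V\<close> matters.\<close>

definition F_stable :: "('r, 'b) relstr \<Rightarrow> 'd set \<Rightarrow> ('d, 'b) emap set \<Rightarrow> bool" where
  "F_stable B D F \<longleftrightarrow> (\<forall>V :: nat set. finite V \<and> V \<noteq> {} \<longrightarrow>
     (\<forall>t\<in>T_set D F V. t ` apps V F = univ B) \<and>
     surjectively_closed B (apps V F) (T_set D F V))"

subsection \<open>Existence of the least definable superset\<close>

lemma and_definable_Int_Inter:
  assumes "finite \<Y>" "\<And>Y. Y \<in> \<Y> \<Longrightarrow> and_definable B S Y"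
  shows "and_definable B S ((S \<rightarrow>\<^sub>E univ B) \<inter> \<Inter>\<Y>)"
  using assms
proof (induction \<Y> rule: finite_induct)
  case empty
  show ?case unfolding and_definable_def by (rule exI[of _ "[]"]) simp
next
  case (insert Y \<Y>)
  obtain \<phi> where \<phi>: "\<forall>a\<in>set \<phi>. atom_over B S a"
      "(S \<rightarrow>\<^sub>E univ B) \<inter> \<Inter>\<Y> = {h \<in> S \<rightarrow>\<^sub>E univ B. \<forall>a\<in>set \<phi>. sat B h a}"
    using insert.IH[OF insert.prems] unfolding and_definable_def by auto
  obtain \<psi> where \<psi>: "\<forall>a\<in>set \<psi>. atom_over B S a"
      "Y = {h \<in> S \<rightarrow>\<^sub>E univ B. \<forall>a\<in>set \<psi>. sat B h a}"
    using insert.prems[of Y] unfolding and_definable_def by auto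
  have "(S \<rightarrow>\<^sub>E univ B) \<inter> \<Inter>(insert Y \<Y>) = Y \<inter> ((S \<rightarrow>\<^sub>E univ B) \<inter> \<Inter>\<Y>)"
    by auto
  also have "\<dots> = {h \<in> S \<rightarrow>\<^sub>E univ B. \<forall>a\<in>set (\<psi> @ \<phi>). sat B h a}"
    unfolding \<phi>(2) \<psi>(2) by auto
  finally show ?case
    using \<phi>(1) \<psi>(1) unfolding and_definable_def by (intro exI[of _ "\<psi> @ \<phi>"]) auto
qed

lemma and_hull_least:
  assumes "finite S" "finite (univ B)" "T \<subseteq> S \<rightarrow>\<^sub>E univ B"
  shows "and_definable B S (and_hull B S T)"
    and "T \<subseteq> and_hull B S T"
    and "and_definable B S Y \<Longrightarrow> T \<subseteq> Y \<Longrightarrow> and_hull B S T \<subseteq> Y"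
proof -
  let ?E = "S \<rightarrow>\<^sub>E univ B"
  let ?\<Y> = "{Y. and_definable B S Y \<and> T \<subseteq> Y}"
  have "?\<Y> \<subseteq> Pow ?E" by (auto simp: and_definable_def)
  moreover have "finite ?E" using assms by (intro finite_PiE)
  ultimately have fin: "finite ?\<Y>" by (meson finite_Pow_iff finite_subset)
  have def: "and_definable B S (?E \<inter> \<Inter>?\<Y>)"
    using fin by (rule and_definable_Int_Inter) simp
  have eq: "and_hull B S T = ?E \<inter> \<Inter>?\<Y>"
    unfolding and_hull_def by (rule Least_equality) (use def assms(3) in auto)
  show "and_definable B S (and_hull B S T)" "T \<subseteq> and_hull B S T"
    using def assms(3) unfolding eq by auto
  show "and_definable B S Y \<Longrightarrow> T \<subseteq> Y \<Longrightarrow> and_hull B S T \<subseteq> Y"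
    unfolding eq by auto
qed

subsection \<open>Invariance under renaming of the variables\<close>

lemma compose_eq_self:
  assumes "h \<in> S \<rightarrow>\<^sub>E X" "\<And>s. s \<in> S \<Longrightarrow> f (g s) = h s"
  shows "compose S f g = h"
  using assms by (auto simp: compose_def fun_eq_iff PiE_def extensional_def)

lemma and_definable_rename:
  fixes B :: "('r, 'b) relstr" and S :: "'s set" and S' :: "'u set"
  assumes \<beta>: "bij_betw \<beta> S' S" and X: "and_definable B S X"
  shows "and_definable B S' ((\<lambda>h. compose S' h \<beta>) ` X)"
proof -
  define \<delta> where "\<delta> = inv_into S' \<beta>"
  have \<delta>: "\<And>s. s \<in> S \<Longrightarrow> \<delta> s \<in> S' \<and> \<beta> (\<delta> s) = s"
    and \<delta>\<beta>: "\<And>s. s \<in> S' \<Longrightarrow> \<beta> s \<in> S \<and> \<delta> (\<beta> s) = s"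
    unfolding \<delta>_def
    using bij_betw_inv_into_right[OF \<beta>] bij_betw_inv_into_left[OF \<beta>]
      bij_betw_apply[OF \<beta>] bij_betw_apply[OF bij_betw_inv_into[OF \<beta>]] by blast+
  obtain \<phi> where \<phi>: "\<forall>a\<in>set \<phi>. atom_over B S a"
    "X = {h \<in> S \<rightarrow>\<^sub>E univ B. \<forall>a\<in>set \<phi>. sat B h a}"
    using X unfolding and_definable_def by auto
  let ?\<phi> = "map (map_atom id \<delta>) \<phi>"
  have over: "atom_over B S' (map_atom id \<delta> a)" if "atom_over B S a" for a :: "('r, 's) atom"
    using that \<delta> by (cases a) (auto simp: tuples_def)
  have sat: "sat B (compose S' h \<beta>) (map_atom id \<delta> a) = sat B h a"
    if "atom_over B S a" for h and a :: "('r, 's) atom"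
  proof (cases a)
    case (Rel R vs)
    then have "set vs \<subseteq> S" using that by (auto simp: tuples_def)
    then have "map (compose S' h \<beta> \<circ> \<delta>) vs = map h vs"
      using \<delta> by (auto simp: compose_def)
    then show ?thesis
      unfolding Rel by (simp only: atom.map sat.simps list.map_comp id_apply)
  qed (use that \<delta> in \<open>auto simp: compose_def\<close>)
  have "(\<lambda>h. compose S' h \<beta>) ` X = {h \<in> S' \<rightarrow>\<^sub>E univ B. \<forall>a\<in>set ?\<phi>. sat B h a}"
  proof (intro equalityI subsetI)
    fix h' assume "h' \<in> (\<lambda>h. compose S' h \<beta>) ` X"
    then obtain h where h: "h \<in> X" "h' = compose S' h \<beta>" by auto
    then have "h' \<in> S' \<rightarrow>\<^sub>E univ B" using \<delta>\<beta> by (auto simp: \<phi>(2) compose_def)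
    then show "h' \<in> {h \<in> S' \<rightarrow>\<^sub>E univ B. \<forall>a\<in>set ?\<phi>. sat B h a}"
      using h \<phi> sat by auto
  next
    fix h' assume h': "h' \<in> {h \<in> S' \<rightarrow>\<^sub>E univ B. \<forall>a\<in>set ?\<phi>. sat B h a}"
    let ?h = "compose S h' \<delta>"
    have eq: "compose S' ?h \<beta> = h'"
      using h' \<delta>\<beta> by (intro compose_eq_self[where X = "univ B"]) (auto simp: compose_def)
    have "?h \<in> S \<rightarrow>\<^sub>E univ B" using h' \<delta> by (auto simp: compose_def)
    moreover have "\<forall>a\<in>set \<phi>. sat B ?h a"
      using h' \<phi>(1) sat[of _ ?h] eq by auto
    ultimately show "h' \<in> (\<lambda>h. compose S' h \<beta>) ` X"
      using eq \<phi>(2) by (intro image_eqI[of _ _ ?h]) auto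
  qed
  then show ?thesis
    using \<phi>(1) over unfolding and_definable_def by (intro exI[of _ ?\<phi>]) auto
qed

lemma surjectively_closed_rename:
  assumes fin: "finite S" "finite (univ B)" and T: "T \<subseteq> S \<rightarrow>\<^sub>E univ B"
    and \<beta>: "bij_betw \<beta> S' S" and closed: "surjectively_closed B S T"
  shows "surjectively_closed B S' ((\<lambda>h. compose S' h \<beta>) ` T)"
  unfolding surjectively_closed_def
proof (intro ballI impI)
  let ?\<Phi> = "\<lambda>h. compose S' h \<beta>"
  have \<beta>S: "\<beta> ` S' = S" using \<beta> by (simp add: bij_betw_def)
  have fin': "finite S'" using \<beta> fin(1) bij_betw_finite by blast
  have T': "?\<Phi> ` T \<subseteq> S' \<rightarrow>\<^sub>E univ B" using T \<beta>S by (fastforce simp: compose_def)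
  fix h' assume h': "h' \<in> and_hull B S' (?\<Phi> ` T)" "h' ` S' = univ B"
  have "and_hull B S' (?\<Phi> ` T) \<subseteq> ?\<Phi> ` and_hull B S T"
    using and_definable_rename[OF \<beta>] and_hull_least[OF fin T]
    by (intro and_hull_least(3)[OF fin' fin(2) T']) auto
  then obtain h where h: "h \<in> and_hull B S T" "h' = ?\<Phi> h" using h'(1) by auto
  have "h' ` S' = h ` (\<beta> ` S')" unfolding h(2) compose_def image_image by auto
  then have "h ` S = univ B" using h'(2) \<beta>S by simp
  then obtain \<gamma> t where t: "automorphism B \<gamma>" "t \<in> T" "h = compose S \<gamma> t"
    using closed h(1) unfolding surjectively_closed_def by blast
  have "h' = compose S' \<gamma> (?\<Phi> t)"
    unfolding h(2) t(3) using \<beta>S by (auto simp: compose_def fun_eq_iff)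
  then show "\<exists>\<gamma> t. automorphism B \<gamma> \<and> t \<in> ?\<Phi> ` T \<and> h' = compose S' \<gamma> t"
    using t by blast
qed

lemma finite_apps:
  assumes "finite V" "finite F"
  shows "finite (apps V F)"
proof -
  have "apps V F = (\<Union>f\<in>F. (\<lambda>vs. (vs, f)) ` tuples V (fst f))"
    by (auto simp: apps_def)
  then show ?thesis
    using assms finite_lists_length_eq[OF assms(1)] by (simp add: tuples_def)
qed

lemma T_set_subset:
  assumes "encoding B D F"
  shows "T_set D F V \<subseteq> apps V F \<rightarrow>\<^sub>E univ B"
proof
  fix t assume "t \<in> T_set D F V"
  then obtain g where g: "g \<in> V \<rightarrow>\<^sub>E D" "t = t_map V F g" by (auto simp: T_set_def)
  have "app_value g \<alpha> \<in> univ B" if \<alpha>: "\<alpha> \<in> apps V F" for \<alpha>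
  proof -
    obtain vs k f where eq: "\<alpha> = (vs, k, f)" by (cases \<alpha>) auto
    then have "(k, f) \<in> F" "vs \<in> tuples V k" using \<alpha> by (auto simp: apps_def)
    moreover from this g(1) have "map g vs \<in> tuples D k" by (auto simp: tuples_def)
    ultimately show ?thesis
      using assms unfolding eq encoding_def app_value_def by fastforce
  qed
  then show "t \<in> apps V F \<rightarrow>\<^sub>E univ B" unfolding g(2) t_map_def by auto
qed

lemma surjectively_closed_T_set_bij:
  fixes B :: "('r, 'b) relstr" and F :: "('d, 'b) emap set"
    and V :: "'v set" and V' :: "'w set"
  assumes B: "finite_relstr B" and F: "encoding B D F" and V: "finite V"
    and \<phi>: "bij_betw \<phi> V' V" and closed: "surjectively_closed B (apps V F) (T_set D F V)"
  shows "surjectively_closed B (apps V' F) (T_set D F V')"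
proof -
  define \<psi> where "\<psi> = inv_into V' \<phi>"
  have \<psi>: "\<And>v. v \<in> V \<Longrightarrow> \<psi> v \<in> V' \<and> \<phi> (\<psi> v) = v"
    and \<phi>': "\<And>v. v \<in> V' \<Longrightarrow> \<phi> v \<in> V \<and> \<psi> (\<phi> v) = v"
    unfolding \<psi>_def
    using bij_betw_inv_into_right[OF \<phi>] bij_betw_inv_into_left[OF \<phi>]
      bij_betw_apply[OF \<phi>] bij_betw_apply[OF bij_betw_inv_into[OF \<phi>]] by blast+
  let ?\<beta> = "\<lambda>(vs, f :: ('d, 'b) emap). (map \<phi> vs, f)"
  let ?\<beta>' = "\<lambda>(vs, f :: ('d, 'b) emap). (map \<psi> vs, f)"
  have bij: "bij_betw ?\<beta> (apps V' F) (apps V F)"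
    by (rule bij_betw_byWitness[where f' = ?\<beta>'])
       (use \<psi> \<phi>' in \<open>auto simp: apps_def tuples_def subset_iff intro!: map_idI\<close>)
  have key: "compose (apps V' F) (t_map V F g) ?\<beta> = t_map V' F g'"
    if "\<And>v. v \<in> V' \<Longrightarrow> g' v = g (\<phi> v)" for g and g' :: "'w \<Rightarrow> 'd"
  proof
    fix \<alpha> :: "'w list \<times> ('d, 'b) emap"
    obtain vs k f where \<alpha>: "\<alpha> = (vs, k, f)" by (cases \<alpha>) auto
    show "compose (apps V' F) (t_map V F g) ?\<beta> \<alpha> = t_map V' F g' \<alpha>"
    proof (cases "\<alpha> \<in> apps V' F")
      case True
      then have "set vs \<subseteq> V'" by (auto simp: \<alpha> apps_def tuples_def)
      then have "map (g \<circ> \<phi>) vs = map g' vs" using that by auto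
      then have "f (map (g \<circ> \<phi>) vs) = f (map g' vs)" by (rule arg_cong)
      moreover have "?\<beta> \<alpha> \<in> apps V F" using bij True by (auto simp: bij_betw_def)
      ultimately show ?thesis
        using True by (simp add: \<alpha> compose_def t_map_def app_value_def)
    qed (simp add: compose_def t_map_def)
  qed
  have "(\<lambda>h. compose (apps V' F) h ?\<beta>) ` T_set D F V = T_set D F V'"
  proof (intro equalityI subsetI)
    fix t assume "t \<in> (\<lambda>h. compose (apps V' F) h ?\<beta>) ` T_set D F V"
    then obtain g where g: "g \<in> V \<rightarrow>\<^sub>E D" "t = compose (apps V' F) (t_map V F g) ?\<beta>"
      by (auto simp: T_set_def)
    have "t = t_map V' F (compose V' g \<phi>)"
      unfolding g(2) by (rule key) (simp add: compose_def)
    moreover have "compose V' g \<phi> \<in> V' \<rightarrow>\<^sub>E D" using g(1) \<phi>' by (auto simp: compose_def)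
    ultimately show "t \<in> T_set D F V'" by (auto simp: T_set_def)
  next
    fix t assume "t \<in> T_set D F V'"
    then obtain g' where g': "g' \<in> V' \<rightarrow>\<^sub>E D" "t = t_map V' F g'" by (auto simp: T_set_def)
    have "compose V g' \<psi> \<in> V \<rightarrow>\<^sub>E D" using g'(1) \<psi> by (auto simp: compose_def)
    moreover have "t = compose (apps V' F) (t_map V F (compose V g' \<psi>)) ?\<beta>"
      unfolding g'(2) by (rule key[symmetric]) (use \<phi>' in \<open>auto simp: compose_def\<close>)
    ultimately show "t \<in> (\<lambda>h. compose (apps V' F) h ?\<beta>) ` T_set D F V"
      by (auto simp: T_set_def)
  qed
  moreover have "finite (apps V F)" using V F by (auto simp: encoding_def intro: finite_apps)
  moreover have "finite (univ B)" using B by (simp add: finite_relstr_def)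
  ultimately show ?thesis
    using surjectively_closed_rename[OF _ _ T_set_subset[OF F] bij closed] by simp
qed

lemma surjectively_closed_T_set_card:
  fixes V :: "'v set" and V' :: "'w set"
  assumes "finite_relstr B" "encoding B D F" "finite V" "finite V'" "card V = card V'"
  shows "surjectively_closed B (apps V F) (T_set D F V) \<longleftrightarrow>
    surjectively_closed B (apps V' F) (T_set D F V')"
proof -
  obtain \<phi> where "bij_betw \<phi> V' V"
    using assms finite_same_card_bij[of V' V] by auto
  moreover obtain \<psi> where "bij_betw \<psi> V V'"
    using assms finite_same_card_bij[of V V'] by auto
  ultimately show ?thesis
    using surjectively_closed_T_set_bij[OF assms(1,2,3)]
      surjectively_closed_T_set_bij[OF assms(1,2,4)] by (intro iffI)
qed

end

theory Submission
  imports Defs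
begin

text \<open>The constants in \<open>F\<close> record how a map \<open>h\<close> in the hull of \<open>T\<^sub>V\<close> must act on \<open>B\<close>:
  if the restriction of \<open>h\<close> to the applications over some \<open>W \<subseteq> V\<close> has the form
  \<open>\<gamma> \<circ> t[g]\<close>, then \<open>\<gamma> b = h(b\<^sub>0)\<close>. Choosing one preimage under \<open>h\<close> of each element of \<open>B\<close>
  involves at most \<open>card B\<close> variables, since arities are at most one; the hypothesis for this set
  \<open>W\<close> shows that \<open>b \<mapsto> h(b\<^sub>0)\<close> is an automorphism. Hence \<open>h\<close> is already surjective on the
  applications over each single variable \<open>v\<close>, and the hypothesis for \<open>{v}\<close> gives the value at
  \<open>v\<close> of the required \<open>g\<close>.\<close>

section \<open>Formulas and hulls on a smaller set of variables\<close>

lemma sat_restrict: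
  assumes "atom_over B S' a"
  shows "sat B (restrict h S') a \<longleftrightarrow> sat B h a"
proof (cases a)
  case (Rel R vs)
  then have "map (restrict h S') vs = map h vs"
    using assms by (auto simp: tuples_def)
  then show ?thesis unfolding Rel by (simp only: sat.simps)
qed (use assms in auto)

lemma atom_over_mono:
  assumes "atom_over B S' a" "S' \<subseteq> S"
  shows "atom_over B S a"
  using assms by (cases a) (auto simp: tuples_def)

lemma and_hull_subset:
  assumes "finite S" "finite (univ B)" "T \<subseteq> S \<rightarrow>\<^sub>E univ B"
  shows "and_hull B S T \<subseteq> S \<rightarrow>\<^sub>E univ B"
  using and_hull_least(1)[OF assms] by (auto simp: and_definable_def)

text \<open>A formula defining the hull over \<open>S'\<close> is also a formula over
  \<open>S\<close> that ignores values outside \<open>S'\<close>. Read over \<open>S\<close>, it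
  holds on all of \<open>T\<close>, hence on the hull of \<open>T\<close> and in particular at
  \<open>h\<close>.\<close>

lemma and_hull_restrict:
  assumes fin: "finite S" "finite (univ B)" and T: "T \<subseteq> S \<rightarrow>\<^sub>E univ B"
    and S': "S' \<subseteq> S" and T': "T' \<subseteq> S' \<rightarrow>\<^sub>E univ B"
    and TT': "\<And>t. t \<in> T \<Longrightarrow> restrict t S' \<in> T'" and h: "h \<in> and_hull B S T"
  shows "restrict h S' \<in> and_hull B S' T'"
proof -
  have fin': "finite S'" using S' fin(1) by (rule finite_subset)
  note hull' = and_hull_least[OF fin' fin(2) T']
  obtain \<phi> where \<phi>: "\<forall>a\<in>set \<phi>. atom_over B S' a"
    "and_hull B S' T' = {h \<in> S' \<rightarrow>\<^sub>E univ B. \<forall>a\<in>set \<phi>. sat B h a}"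
    using hull'(1) unfolding and_definable_def by auto
  let ?Y = "{h \<in> S \<rightarrow>\<^sub>E univ B. \<forall>a\<in>set \<phi>. sat B h a}"
  have "and_definable B S ?Y"
    unfolding and_definable_def using \<phi>(1) atom_over_mono[OF _ S'] by blast
  moreover have "T \<subseteq> ?Y"
  proof
    fix t assume t: "t \<in> T"
    then have "restrict t S' \<in> and_hull B S' T'" using TT' hull'(2) by blast
    then show "t \<in> ?Y" using t T \<phi> by (auto simp: sat_restrict)
  qed
  ultimately have "h \<in> ?Y" using and_hull_least(3)[OF fin T] h by blast
  then show ?thesis using \<phi> S' by (auto simp: sat_restrict)
qed

section \<open>Restriction of encoded assignments, and the constant applications\<close>

lemma apps_mono: "W \<subseteq> V \<Longrightarrow> apps W F \<subseteq> apps V F"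
  by (auto simp: apps_def tuples_def)

lemma t_map_restrict:
  assumes "W \<subseteq> V"
  shows "restrict (t_map V F g) (apps W F) = t_map W F (restrict g W)"
proof
  fix \<alpha> :: "'a list \<times> ('b, 'c) emap"
  obtain vs k f where \<alpha>: "\<alpha> = (vs, k, f)" by (cases \<alpha>) auto
  show "restrict (t_map V F g) (apps W F) \<alpha> = t_map W F (restrict g W) \<alpha>"
  proof (cases "\<alpha> \<in> apps W F")
    case True
    then have "map g vs = map (restrict g W) vs" by (auto simp: \<alpha> apps_def tuples_def)
    then have "f (map g vs) = f (map (restrict g W) vs)" by (rule arg_cong)
    moreover have "\<alpha> \<in> apps V F" using True apps_mono[OF assms] by blast
    ultimately show ?thesis using True by (simp add: t_map_def app_value_def \<alpha>)
  qed (simp add: t_map_def)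
qed

lemma T_set_restrict:
  assumes "W \<subseteq> V" "t \<in> T_set D F V"
  shows "restrict t (apps W F) \<in> T_set D F W"
proof -
  obtain g where g: "g \<in> V \<rightarrow>\<^sub>E D" "t = t_map V F g" using assms(2) by (auto simp: T_set_def)
  then have "restrict g W \<in> W \<rightarrow>\<^sub>E D" using assms(1) by auto
  then show ?thesis unfolding g(2) t_map_restrict[OF assms(1)] T_set_def by blast
qed

lemma const_app_in_apps:
  assumes "const_maps B \<subseteq> F" "b \<in> univ B"
  shows "([], const_map b) \<in> apps V F"
  using assms by (auto simp: apps_def const_maps_def const_map_def tuples_def)

text \<open>An application to the empty tuple involves no variable, so no choice of \<open>g\<close>
  can change its value.\<close>

lemma t_map_const:
  assumes "const_maps B \<subseteq> F" "b \<in> univ B"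
  shows "t_map V F g ([], const_map b) = b"
  using const_app_in_apps[OF assms, of V] by (simp add: t_map_def app_value_def const_map_def)

text \<open>The constant applications alone reach every element of \<open>univ B\<close>. This
  settles the surjectivity clause of stability, leaving only surjective closedness.\<close>

lemma T_set_surj:
  assumes "encoding B D F" "const_maps B \<subseteq> F" "t \<in> T_set D F V"
  shows "t ` apps V F = univ B"
proof
  show "t ` apps V F \<subseteq> univ B" using T_set_subset[OF assms(1)] assms(3) by fastforce
  obtain g where t: "t = t_map V F g" using assms(3) by (auto simp: T_set_def)
  show "univ B \<subseteq> t ` apps V F"
  proof
    fix b assume "b \<in> univ B"
    note b = assms(2) this
    show "b \<in> t ` apps V F"
      unfolding t using const_app_in_apps[OF b]
      by (rule image_eqI[rotated]) (simp add: t_map_const[OF b])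
  qed
qed

section \<open>From small sets of variables to all of \<open>V\<close>\<close>

text \<open>\<open>h\<close> lives over \<open>V\<close>, but closedness is used only over
  \<open>W\<close>. The last conclusion describes \<open>\<gamma>\<close> on \<open>univ B\<close>
  by \<open>h\<close> alone, so automorphisms obtained from different sets \<open>W\<close> agree
  there.\<close>

lemma hull_factorization:
  assumes B: "finite_relstr B" and F: "encoding B D F" and const: "const_maps B \<subseteq> F"
    and V: "finite V" and W: "W \<subseteq> V"
    and closed: "surjectively_closed B (apps W F) (T_set D F W)"
    and h: "h \<in> and_hull B (apps V F) (T_set D F V)"
    and surj: "univ B \<subseteq> h ` apps W F"
  obtains \<gamma> g where "automorphism B \<gamma>" "g \<in> W \<rightarrow>\<^sub>E D"
    "\<And>\<alpha>. \<alpha> \<in> apps W F \<Longrightarrow> h \<alpha> = \<gamma> (app_value g \<alpha>)"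
    "\<And>b. b \<in> univ B \<Longrightarrow> \<gamma> b = h ([], const_map b)"
proof -
  have fin: "finite (apps V F)" "finite (univ B)"
    using V F B by (auto simp: encoding_def finite_relstr_def intro: finite_apps)
  let ?h = "restrict h (apps W F)"
  have hull: "?h \<in> and_hull B (apps W F) (T_set D F W)"
    using and_hull_restrict[OF fin T_set_subset[OF F] apps_mono[OF W] T_set_subset[OF F]
        T_set_restrict[OF W] h] .
  have "finite (apps W F)" using fin(1) apps_mono[OF W] finite_subset by blast
  then have "?h \<in> apps W F \<rightarrow>\<^sub>E univ B"
    using and_hull_subset[OF _ fin(2) T_set_subset[OF F]] hull by blast
  then have "?h ` apps W F = univ B" using surj by fastforce
  then obtain \<gamma> t where \<gamma>: "automorphism B \<gamma>" "t \<in> T_set D F W" "?h = compose (apps W F) \<gamma> t"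
    using closed hull unfolding surjectively_closed_def by blast
  obtain g where g: "g \<in> W \<rightarrow>\<^sub>E D" "t = t_map W F g" using \<gamma>(2) by (auto simp: T_set_def)
  have val: "h \<alpha> = \<gamma> (t \<alpha>)" if "\<alpha> \<in> apps W F" for \<alpha>
    using fun_cong[OF \<gamma>(3), of \<alpha>] that by (simp add: compose_def)
  show thesis
  proof (rule that[OF \<gamma>(1) g(1)])
    show "h \<alpha> = \<gamma> (app_value g \<alpha>)" if "\<alpha> \<in> apps W F" for \<alpha>
      using val[OF that] that by (simp add: g(2) t_map_def)
    show "\<gamma> b = h ([], const_map b)" if "b \<in> univ B" for b
      using val[OF const_app_in_apps[OF const that]]
      by (simp add: g(2) t_map_const[OF const that])
  qed
qed

lemma small_variable_set:
  assumes fin: "finite (univ B)" "univ B \<noteq> {}"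
    and ar: "\<forall>(k, f)\<in>F. k \<le> 1" and V: "V \<noteq> {}" and surj: "h ` apps V F = univ B"
  obtains W where "W \<subseteq> V" "finite W" "1 \<le> card W" "card W \<le> card (univ B)"
    "univ B \<subseteq> h ` apps W F"
proof -
  obtain v\<^sub>0 where v\<^sub>0: "v\<^sub>0 \<in> V" using V by auto
  have "\<exists>v\<in>V. b \<in> h ` apps {v} F" if "b \<in> univ B" for b
  proof -
    have "b \<in> h ` apps V F" using surj that by simp
    then obtain \<alpha> where \<alpha>: "\<alpha> \<in> apps V F" "b = h \<alpha>" by blast
    obtain vs k f where eq: "\<alpha> = (vs, k, f)" by (cases \<alpha>) auto
    have vs: "(k, f) \<in> F" "set vs \<subseteq> V" "length vs = k" "k \<le> 1"
      using \<alpha>(1) ar by (auto simp: eq apps_def tuples_def)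
    \<comment> \<open>A nullary application has no variable of its own; \<open>v\<^sub>0\<close>
      stands in for it.\<close>
    then have "\<exists>v\<in>V. set vs \<subseteq> {v}" using v\<^sub>0 by (cases vs) auto
    then show ?thesis using \<alpha>(2) vs by (fastforce simp: eq apps_def tuples_def)
  qed
  then obtain v where v: "\<And>b. b \<in> univ B \<Longrightarrow> v b \<in> V \<and> b \<in> h ` apps {v b} F" by metis
  show thesis
  proof (rule that)
    show "v ` univ B \<subseteq> V" using v by blast
    show "finite (v ` univ B)" "card (v ` univ B) \<le> card (univ B)"
      using fin by (auto intro: card_image_le)
    show "1 \<le> card (v ` univ B)" using fin by (simp add: Suc_le_eq card_gt_0_iff)
    show "univ B \<subseteq> h ` apps (v ` univ B) F"
    proof
      fix b assume b: "b \<in> univ B"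
      then have "apps {v b} F \<subseteq> apps (v ` univ B) F" by (intro apps_mono) auto
      then show "b \<in> h ` apps (v ` univ B) F" using v[OF b] by blast
    qed
  qed
qed

lemma surjectively_closed_T_set:
  assumes B: "finite_relstr B" and F: "encoding B D F" and ar: "\<forall>(k, f)\<in>F. k \<le> 1"
    and const: "const_maps B \<subseteq> F" and V: "finite V" "V \<noteq> {}"
    and closed: "\<And>W. W \<subseteq> V \<Longrightarrow> 1 \<le> card W \<Longrightarrow> card W \<le> card (univ B) \<Longrightarrow>
      surjectively_closed B (apps W F) (T_set D F W)"
  shows "surjectively_closed B (apps V F) (T_set D F V)"
  unfolding surjectively_closed_def
proof (intro ballI impI)
  fix h assume h: "h \<in> and_hull B (apps V F) (T_set D F V)" "h ` apps V F = univ B"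
  have fin: "finite (univ B)" "univ B \<noteq> {}" using B by (auto simp: finite_relstr_def)
  note factor = hull_factorization[OF B F const V(1) _ _ h(1)]
  obtain W where W: "W \<subseteq> V" "1 \<le> card W" "card W \<le> card (univ B)" "univ B \<subseteq> h ` apps W F"
    using small_variable_set[OF fin ar V(2) h(2)] by metis
  obtain \<gamma> where \<gamma>: "automorphism B \<gamma>" "\<And>b. b \<in> univ B \<Longrightarrow> \<gamma> b = h ([], const_map b)"
    by (rule factor[OF W(1) closed[OF W(1-3)] W(4)], rule that)
  \<comment> \<open>Now any \<open>W\<close> will do, even the empty set: \<open>\<gamma>\<close>
    permutes \<open>univ B\<close>, so the values of \<open>h\<close> at the constant applications
    already exhaust it.\<close>
  have surj: "univ B \<subseteq> h ` apps W F" for W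
  proof
    fix b assume "b \<in> univ B"
    also have "univ B = \<gamma> ` univ B"
      using \<gamma>(1) by (simp add: automorphism_def bij_betw_def)
    finally obtain c where c: "c \<in> univ B" "\<gamma> c = b" by blast
    show "b \<in> h ` apps W F"
      using const_app_in_apps[OF const c(1)]
      by (rule image_eqI[rotated]) (simp add: c(2) \<gamma>(2)[OF c(1), symmetric])
  qed
  \<comment> \<open>Needed because two automorphisms can be compared only on \<open>univ B\<close>;
    nothing is known about them elsewhere.\<close>
  have value_in: "app_value g \<alpha> \<in> univ B" if "g \<in> W \<rightarrow>\<^sub>E D" "\<alpha> \<in> apps W F" for g \<alpha> W
  proof -
    have "t_map W F g \<in> apps W F \<rightarrow>\<^sub>E univ B"
      using T_set_subset[OF F, of W] that(1) by (auto simp: T_set_def)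
    then show ?thesis using that(2) by (auto simp: t_map_def dest: PiE_mem)
  qed
  \<comment> \<open>Over \<open>{v}\<close> an assignment matters only through its value at
    \<open>v\<close>, so it is replaced by a constant function. The automorphism is the fixed
    \<open>\<gamma>\<close>, independent of \<open>v\<close>; this is what lets the values
    \<open>d\<close> be glued.\<close>
  have "\<exists>d\<in>D. \<forall>\<alpha>\<in>apps {v} F. h \<alpha> = \<gamma> (app_value (\<lambda>_. d) \<alpha>)" if v: "v \<in> V" for v
  proof -
    have "1 \<le> card (univ B)" using fin by (simp add: Suc_le_eq card_gt_0_iff)
    then have "surjectively_closed B (apps {v} F) (T_set D F {v})"
      using v by (intro closed) auto
    from _ this obtain \<gamma>' g where g: "g \<in> {v} \<rightarrow>\<^sub>E D"
      "\<And>\<alpha>. \<alpha> \<in> apps {v} F \<Longrightarrow> h \<alpha> = \<gamma>' (app_value g \<alpha>)"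
      "\<And>b. b \<in> univ B \<Longrightarrow> \<gamma>' b = h ([], const_map b)"
      using v by (elim factor[OF _ _ surj, rotated]) auto
    have "h \<alpha> = \<gamma> (app_value (\<lambda>_. g v) \<alpha>)" if \<alpha>: "\<alpha> \<in> apps {v} F" for \<alpha>
    proof -
      obtain vs k f where eq: "\<alpha> = (vs, k, f)" by (cases \<alpha>) auto
      have "map g vs = map (\<lambda>_. g v) vs" using \<alpha> by (auto simp: eq apps_def tuples_def)
      then have "app_value g \<alpha> = app_value (\<lambda>_. g v) \<alpha>" by (simp only: eq app_value_def prod.case)
      then show ?thesis using g(2)[OF \<alpha>] g(3) \<gamma>(2) value_in[OF g(1) \<alpha>] by simp
    qed
    then show ?thesis using g(1) by (intro bexI[of _ "g v"]) auto
  qed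
  then obtain d where d: "\<And>v. v \<in> V \<Longrightarrow> d v \<in> D"
    "\<And>v \<alpha>. v \<in> V \<Longrightarrow> \<alpha> \<in> apps {v} F \<Longrightarrow> h \<alpha> = \<gamma> (app_value (\<lambda>_. d v) \<alpha>)"
    by metis
  \<comment> \<open>The glued assignment. Each application uses at most one variable, so its value
    under \<open>?g\<close> is the one found for that variable alone.\<close>
  let ?g = "restrict d V"
  have val: "h \<alpha> = \<gamma> (t_map V F ?g \<alpha>)" if \<alpha>: "\<alpha> \<in> apps V F" for \<alpha>
  proof -
    obtain vs k f where eq: "\<alpha> = (vs, k, f)" by (cases \<alpha>) auto
    have vs: "(k, f) \<in> F" "set vs \<subseteq> V" "length vs = k" "k \<le> 1"
      using \<alpha> ar by (auto simp: eq apps_def tuples_def)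
    \<comment> \<open>If \<open>vs\<close> is empty, any variable serves, and \<open>V\<close> is
      nonempty.\<close>
    then obtain v where v: "v \<in> V" "set vs \<subseteq> {v}" using V(2) by (cases vs) auto
    have "\<alpha> \<in> apps {v} F" using v vs by (auto simp: eq apps_def tuples_def)
    then have "h \<alpha> = \<gamma> (app_value (\<lambda>_. d v) \<alpha>)" using d(2) v(1) by blast
    moreover have "map ?g vs = map (\<lambda>_. d v) vs" using v by auto
    then have "app_value ?g \<alpha> = app_value (\<lambda>_. d v) \<alpha>" by (simp only: eq app_value_def prod.case)
    ultimately show ?thesis using \<alpha> by (simp add: t_map_def)
  qed
  have "finite (apps V F)" using V F by (auto simp: encoding_def intro: finite_apps)
  then have "h \<in> apps V F \<rightarrow>\<^sub>E univ B"
    using and_hull_subset[OF _ fin(1) T_set_subset[OF F]] h(1) by blast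
  then have "h = compose (apps V F) \<gamma> (t_map V F ?g)"
    using val by (intro compose_eq_self[symmetric, where X = "univ B"]) auto
  moreover have "t_map V F ?g \<in> T_set D F V" using d(1) by (auto simp: T_set_def)
  ultimately show "\<exists>\<gamma> t. automorphism B \<gamma> \<and> t \<in> T_set D F V \<and> h = compose (apps V F) \<gamma> t"
    using \<gamma>(1) by blast
qed

theorem theorem6p1:
  fixes B :: "('r, 'b) relstr" and D :: "'d set" and F :: "('d, 'b) emap set"
  assumes "finite_relstr B"
    and "finite D"
    and "encoding B D F"
    and "\<forall>(k, f)\<in>F. k \<le> 1"
    and "const_maps B \<subseteq> F"
  shows "F_stable B D F \<longleftrightarrow>
    (\<forall>W :: nat set. finite W \<and> 1 \<le> card W \<and> card W \<le> card (univ B) \<longrightarrow>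
       surjectively_closed B (apps W F) (T_set D F W))"
proof
  assume "F_stable B D F"
  then show "\<forall>W :: nat set. finite W \<and> 1 \<le> card W \<and> card W \<le> card (univ B) \<longrightarrow>
      surjectively_closed B (apps W F) (T_set D F W)"
    unfolding F_stable_def by fastforce
next
  assume small: "\<forall>W :: nat set. finite W \<and> 1 \<le> card W \<and> card W \<le> card (univ B) \<longrightarrow>
      surjectively_closed B (apps W F) (T_set D F W)"
  have "surjectively_closed B (apps V F) (T_set D F V)" if "finite V" "V \<noteq> {}" for V :: "nat set"
    by (rule surjectively_closed_T_set[OF assms(1,3-5) that])
       (use small finite_subset[OF _ that(1)] in simp)
  then show "F_stable B D F"
    unfolding F_stable_def by (simp add: T_set_surj[OF assms(3,5)])
qed

end
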